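(* For every integer $n\ge 0$ and every $t\in\mathbb{F}_2^{n+1}$, the Krull dimension of the toric ring $R(n,t)=S(n)/I_{G_n^t}$ is $$\dim R(n,t)=n+3.$$
   Context: Throughout, $k$ is a field. Ladder-like structures. For $n\ge 0$ and $t=(t_1,\dots,t_{n+1})\in\mathbb{F}_2^{n+1}$, $L_n^t$ is a partially filled array with $\lfloor n/2\rfloor+2$ rows (numbered top to bottom) and $\lceil n/2\rceil+2$ columns (numbered left to right); its nonzero entries are the variables $x_0,x_2,x_3,\dots,x_{2n+4}$ (there is no $x_1$), each occurring exactly once, all other positions being empty. It is defined recursively, with $\widehat t=(t_1,\dots,t_n)$: - $L_0^t$ has first row $x_0,x_2$ and second row $x_3,x_4$ (for both values of $t$). - $L_1^t$ has first row $x_0,x_2,x_5$ and second row $x_3,x_4,x_6$ (for all $t$). - For $n\ge 2$ even, $L_n^t$ is $L_{n-1}^{\widehat t}$ with a new bottom row added whose only nonzero entries are $x_{2n+4}$, in the last column, and $x_{2n+3}$, in the column containing the first (if $t_{n+1}=0$) or the second (if $t_{n+1}=1$) nonzero entry, from left to right, of the row immediately above the new row. - For $n\ge 3$ odd, $L_n^t$ is $L_{n-1}^{\widehat t}$ with a new rightmost column added whose only nonzero entries are $x_{2n+4}$, in the last row, and $x_{2n+3}$, in the row containing the first (if $t_{n+1}=0$) or the second (if $t_{n+1}=1$) nonzero entry, from top to bottom, of the column immediately to the left of the new column. Graphs and toric rings. $G_n^t$ is the bipartite graph with one vertex for each row and one vertex for each column of $L_n^t$, and, for each nonzero entry $x_j$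 of $L_n^t$, one edge (called $x_j$) joining the vertex of its row to the vertex of its column. Let $V$ be its vertex set, $S(n)=k[x_0,x_2,x_3,\dots,x_{2n+4}]$ the polynomial ring on the edges, and $I_{G_n^t}$ (the toric ideal) the kernel of the $k$-algebra homomorphism $S(n)\to k[V]$ sending each edge to the product of its two endpoints. The toric ring is $R(n,t)=S(n)/I_{G_n^t}$. *)

theory Defs
  imports
    "HOL-Library.Z2"
    "HOL-Library.Extended_Nat"
    "HOL-Library.Poly_Mapping"
    "HOL-Algebra.QuotRing"
    "HOL-Algebra.Algebraic_Closure_Type"
begin

section \<open>Krull dimension\<close>

text \<open>Length counts the strict inclusions in a chain of prime ideals. For the zero ring,
  which has no primes, the value is \<open>0\<close> (the supremum of the empty set).\<close>

definition krull_dim :: "('a, 'm) ring_scheme \<Rightarrow> enat" where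
  "krull_dim R = Sup {enat m | m. \<exists>P :: nat \<Rightarrow> 'a set.
     (\<forall>i\<le>m. primeideal (P i) R) \<and> (\<forall>i<m. P i \<subset> P (Suc i))}"


section \<open>Polynomial rings\<close>

type_synonym ('x, 'k) mpoly = "('x \<Rightarrow>\<^sub>0 nat) \<Rightarrow>\<^sub>0 'k"

definition mvar :: "'x \<Rightarrow> ('x, 'k::field) mpoly" where
  "mvar x = Poly_Mapping.single (Poly_Mapping.single x 1) 1"

definition mconst :: "'k::field \<Rightarrow> ('x, 'k) mpoly" where
  "mconst a = Poly_Mapping.single 0 a"

text \<open>The polynomials in which only variables from \<open>A\<close> occur.\<close>

definition poly_ring :: "'x set \<Rightarrow> ('x, 'k::field) mpoly ring" where
  "poly_ring A = ring_of_type_algebra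
     \<lparr>carrier := {p. \<forall>m \<in> Poly_Mapping.keys p. Poly_Mapping.keys m \<subseteq> A}\<rparr>"

text \<open>The \<open>k\<close>-algebra homomorphism that sends each variable \<open>x\<close> to \<open>f x\<close>.\<close>

definition subst :: "('x \<Rightarrow> ('y, 'k::field) mpoly) \<Rightarrow> ('x, 'k) mpoly \<Rightarrow> ('y, 'k) mpoly" where
  "subst f p = (\<Sum>m \<in> Poly_Mapping.keys p.
     mconst (Poly_Mapping.lookup p m) * (\<Prod>x \<in> Poly_Mapping.keys m. f x ^ Poly_Mapping.lookup m x))"


section \<open>Graphs and toric rings\<close>

record ('v, 'e) graph =
  verts :: "'v set"
  edges :: "'e set"
  ends  :: "'e \<Rightarrow> 'v set"

definition toric_map :: "('v, 'e) graph \<Rightarrow> ('e, 'k::field) mpoly \<Rightarrow> ('v, 'k) mpoly" where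
  "toric_map G = subst (\<lambda>e. \<Prod>v \<in> ends G e. mvar v)"

definition toric_ideal :: "('v, 'e) graph \<Rightarrow> ('e, 'k::field) mpoly set" where
  "toric_ideal G = a_kernel (poly_ring (edges G)) (poly_ring (verts G))
     (toric_map G :: ('e, 'k) mpoly \<Rightarrow> ('v, 'k) mpoly)"

definition toric_ring :: "('v, 'e) graph \<Rightarrow> ('e, 'k::field) mpoly set ring" where
  "toric_ring G = poly_ring (edges G) Quot toric_ideal G"


section \<open>Ladder-like structures\<close>

definition nrows :: "nat \<Rightarrow> nat" where
  "nrows n = n div 2 + 2"

definition ncols :: "nat \<Rightarrow> nat" where
  "ncols n = (n + 1) div 2 + 2"

text \<open>A partially filled array maps each nonempty position (row, column), both counted from
  \<open>1\<close>, to the index \<open>j\<close> of its entry \<open>x\<^sub>j\<close>.\<close>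

type_synonym parray = "nat \<times> nat \<rightharpoonup> nat"

text \<open>The first or the second smallest element of a set of positions.\<close>

definition pick :: "bit \<Rightarrow> nat set \<Rightarrow> nat" where
  "pick b A = sorted_list_of_set A ! (if b = 0 then 0 else 1)"

definition row_support :: "parray \<Rightarrow> nat \<Rightarrow> nat set" where
  "row_support L r = {c. (r, c) \<in> dom L}"

definition col_support :: "parray \<Rightarrow> nat \<Rightarrow> nat set" where
  "col_support L c = {r. (r, c) \<in> dom L}"

definition add_row :: "nat \<Rightarrow> bit \<Rightarrow> parray \<Rightarrow> parray" where
  "add_row n b L = L(
     (nrows n, pick b (row_support L (nrows n - 1))) \<mapsto> 2 * n + 3,
     (nrows n, ncols n) \<mapsto> 2 * n + 4)"

definition add_col :: "nat \<Rightarrow> bit \<Rightarrow> parray \<Rightarrow> parray" where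
  "add_col n b L = L(
     (pick b (col_support L (ncols n - 1)), ncols n) \<mapsto> 2 * n + 3,
     (nrows n, ncols n) \<mapsto> 2 * n + 4)"

text \<open>Intended for lists \<open>t = [t\<^sub>1, \<dots>, t\<^sub>n\<^sub>+\<^sub>1]\<close> of length \<open>n + 1\<close>.\<close>

fun ladder :: "nat \<Rightarrow> bit list \<Rightarrow> parray" where
  "ladder 0 t = [(1, 1) \<mapsto> 0, (1, 2) \<mapsto> 2,
                 (2, 1) \<mapsto> 3, (2, 2) \<mapsto> 4]"
| "ladder (Suc 0) t = [(1, 1) \<mapsto> 0, (1, 2) \<mapsto> 2, (1, 3) \<mapsto> 5,
                       (2, 1) \<mapsto> 3, (2, 2) \<mapsto> 4, (2, 3) \<mapsto> 6]"
| "ladder (Suc (Suc m)) t =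
     (let n = m + 2; L = ladder (Suc m) (butlast t)
      in if even n then add_row n (last t) L else add_col n (last t) L)"

lemma pick_less:
  assumes fin: "finite A" and c: "card (A \<inter> {..<k}) \<ge> 2"
  shows "pick b A \<in> A" "pick b A < k"
proof -
  let ?l = "sorted_list_of_set A"
  have "card (A \<inter> {..<k}) \<le> card A" using fin by (simp add: card_mono)
  then have len: "length ?l \<ge> 2" using c by simp
  have mem: "?l ! 0 \<in> A" "?l ! 1 \<in> A"
    using len nth_mem[of 0 ?l] nth_mem[of 1 ?l] fin by simp_all
  have le: "?l ! 0 \<le> ?l ! 1" using len by (simp add: sorted_nth_mono)
  have "?l ! 1 < k"
  proof (rule ccontr)
    assume "\<not> ?l ! 1 < k"
    moreover have "?l ! 1 \<le> ?l ! i" if "1 \<le> i" "i < length ?l" for i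
      using that by (simp add: sorted_nth_mono)
    ultimately have ge: "k \<le> ?l ! i" if "1 \<le> i" "i < length ?l" for i
      using that by (meson le_trans not_le_imp_less)
    have "A \<inter> {..<k} \<subseteq> {?l ! 0}"
    proof
      fix x assume x: "x \<in> A \<inter> {..<k}"
      then obtain i where i: "i < length ?l" "?l ! i = x"
        using fin by (metis IntD1 in_set_conv_nth set_sorted_list_of_set)
      then have "i = 0" using ge[of i] x by (cases i) auto
      then show "x \<in> {?l ! 0}" using i by simp
    qed
    then have "card (A \<inter> {..<k}) \<le> card {?l ! 0}" by (rule card_mono[rotated]) simp
    then show False using c by simp
  qed
  then show "pick b A \<in> A" "pick b A < k" using mem le by (auto simp: pick_def)
qed

definition ladder_inv :: "nat \<Rightarrow> parray \<Rightarrow> bool" where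
  "ladder_inv n L \<longleftrightarrow>
     dom L \<subseteq> {1..nrows n} \<times> {1..ncols n} \<and> inj_on L (dom L) \<and> ran L = {0} \<union> {2..2 * n + 4} \<and>
     (if even n
      then card (row_support L (nrows n)) \<ge> 2 \<and> card (col_support L (ncols n) \<inter> {..<nrows n}) \<ge> 2
      else card (col_support L (ncols n)) \<ge> 2 \<and> card (row_support L (nrows n) \<inter> {..<ncols n}) \<ge> 2)"

lemma upd2_props:
  assumes "p \<notin> dom L" "q \<notin> dom L" "p \<noteq> q" "inj_on L (dom L)" "i \<notin> ran L" "j \<notin> ran L" "i \<noteq> j"
  shows "inj_on (L(p \<mapsto> i, q \<mapsto> j)) (dom (L(p \<mapsto> i, q \<mapsto> j)))"
    and "ran (L(p \<mapsto> i, q \<mapsto> j)) = insert i (insert j (ran L))"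
    and "dom (L(p \<mapsto> i, q \<mapsto> j)) = insert p (insert q (dom L))"
proof -
  show "inj_on (L(p \<mapsto> i, q \<mapsto> j)) (dom (L(p \<mapsto> i, q \<mapsto> j)))"
    using assms by (auto simp: inj_on_def ran_def dom_def)
  have "L p = None" "(L(p \<mapsto> i)) q = None" using assms by auto
  then show "ran (L(p \<mapsto> i, q \<mapsto> j)) = insert i (insert j (ran L))" by (auto simp: ran_map_upd simp del: fun_upd_apply)
qed auto

lemma ran_the_image: "ran L = the ` L ` dom L"
  by (auto simp: ran_def dom_def image_iff) (metis option.sel)

lemma ladder_inv_ladder:
  assumes "n \<ge> 1"
  shows "ladder_inv n (ladder n t)"
  using assms
proof (induction n t rule: ladder.induct)
  case (2 t)
  let ?L = "ladder (Suc 0) t"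
  have d: "dom ?L = {(1,1),(1,2),(1,3),(2,1),(2,2),(2,3)}" by auto
  have "ran ?L = the ` ?L ` dom ?L" by (rule ran_the_image)
  also have "\<dots> = {0,2,5,3,4,6}" unfolding d by simp
  finally have r: "ran ?L = {0,2,5,3,4,6}" .
  have i: "inj_on ?L (dom ?L)" unfolding d by (simp add: inj_on_def)
  have "row_support ?L 2 \<inter> {..<3} = {1,2}" unfolding row_support_def d by auto
  moreover have "col_support ?L 3 = {1,2}" unfolding col_support_def d by auto
  moreover have "ran ?L = {0} \<union> {2..6}" unfolding r by auto
  moreover have "dom ?L \<subseteq> {1..2} \<times> {1..3}" unfolding d by auto
  moreover have "nrows (Suc 0) = 2" "ncols (Suc 0) = 3" by (simp_all add: nrows_def ncols_def)
  ultimately show ?case using i by (simp add: ladder_inv_def del: ladder.simps)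
next
  case (3 m t)
  define n where "n = m + 2"
  define L where "L = ladder (Suc m) (butlast t)"
  have inv: "ladder_inv (Suc m) L" using 3 by (simp add: L_def)
  have dom: "dom L \<subseteq> {1..nrows (Suc m)} \<times> {1..ncols (Suc m)}" and inj: "inj_on L (dom L)"
    and ran: "ran L = {0} \<union> {2..2 * m + 6}"
    using inv by (auto simp: ladder_inv_def)
  have fresh: "2 * n + 3 \<notin> ran L" "2 * n + 4 \<notin> ran L" by (auto simp: ran n_def)
  have ran': "insert (2 * n + 3) (insert (2 * n + 4) (ran L)) = {0} \<union> {2..2 * n + 4}"
    by (auto simp: ran n_def)
  have "row_support L r \<subseteq> {..ncols (Suc m)}" "col_support L c \<subseteq> {..nrows (Suc m)}" for r c
    using dom by (auto simp: row_support_def col_support_def)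
  then have fin: "finite (row_support L r)" "finite (col_support L c)" for r c
    by (meson finite_atMost finite_subset)+
  show ?case
  proof (cases "even n")
    case True
    have e: "nrows n = nrows (Suc m) + 1" "ncols n = ncols (Suc m)" "odd (Suc m)"
      using True by (auto simp: n_def nrows_def ncols_def elim!: evenE)
    define p where "p = pick (last t) (row_support L (nrows (Suc m)))"
    have p: "p \<in> row_support L (nrows (Suc m))" "p < ncols n"
      using pick_less[OF fin(1)] inv e by (auto simp: p_def ladder_inv_def)
    have p1: "1 \<le> p" using p dom by (auto simp: row_support_def)
    let ?L = "L((nrows n, p) \<mapsto> 2 * n + 3, (nrows n, ncols n) \<mapsto> 2 * n + 4)"
    have L': "ladder (Suc (Suc m)) t = ?L"
      using True e by (simp add: n_def L_def p_def add_row_def Let_def del: fun_upd_apply)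
    have nd: "(nrows n, c) \<notin> dom L" for c using dom e by auto
    have u: "inj_on ?L (dom ?L)" "ran ?L = {0} \<union> {2..2 * n + 4}"
      "dom ?L = insert (nrows n, p) (insert (nrows n, ncols n) (dom L))"
      unfolding ran'[symmetric]
      by (rule upd2_props; use inj fresh nd p in simp)+
    have "row_support ?L (nrows n) = {p, ncols n}"
      unfolding row_support_def u(3) using nd by auto
    then have "card (row_support ?L (nrows n)) = 2" using p by simp
    moreover have "col_support ?L (ncols n) \<inter> {..<nrows n} = col_support L (ncols n)"
      unfolding col_support_def u(3) using dom p e by fastforce
    moreover have "dom ?L \<subseteq> {1..nrows n} \<times> {1..ncols n}"
      unfolding u(3) using dom e p p1 by (auto simp: ncols_def)
    ultimately have "ladder_inv n ?L"
      using inv u(1,2) True e by (simp add: ladder_inv_def del: fun_upd_apply dom_fun_upd)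
    then show ?thesis unfolding L' n_def by (simp only: add_2_eq_Suc')
  next
    case False
    have e: "ncols n = ncols (Suc m) + 1" "nrows n = nrows (Suc m)" "even (Suc m)"
      using False by (auto simp: n_def nrows_def ncols_def elim!: oddE)
    define p where "p = pick (last t) (col_support L (ncols (Suc m)))"
    have p: "p \<in> col_support L (ncols (Suc m))" "p < nrows n"
      using pick_less[OF fin(2)] inv e by (auto simp: p_def ladder_inv_def)
    have p1: "1 \<le> p" using p dom by (auto simp: col_support_def)
    let ?L = "L((p, ncols n) \<mapsto> 2 * n + 3, (nrows n, ncols n) \<mapsto> 2 * n + 4)"
    have L': "ladder (Suc (Suc m)) t = ?L"
      using False e by (simp add: n_def L_def p_def add_col_def Let_def del: fun_upd_apply)
    have nd: "(r, ncols n) \<notin> dom L" for r using dom e by auto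
    have u: "inj_on ?L (dom ?L)" "ran ?L = {0} \<union> {2..2 * n + 4}"
      "dom ?L = insert (p, ncols n) (insert (nrows n, ncols n) (dom L))"
      unfolding ran'[symmetric]
      by (rule upd2_props; use inj fresh nd p in simp)+
    have "col_support ?L (ncols n) = {p, nrows n}"
      unfolding col_support_def u(3) using nd by auto
    then have "card (col_support ?L (ncols n)) = 2" using p by simp
    moreover have "row_support ?L (nrows n) \<inter> {..<ncols n} = row_support L (nrows n)"
      unfolding row_support_def u(3) using dom p e by fastforce
    moreover have "dom ?L \<subseteq> {1..nrows n} \<times> {1..ncols n}"
      unfolding u(3) using dom e p p1 by (auto simp: nrows_def)
    ultimately have "ladder_inv n ?L"
      using inv u(1,2) False e by (simp add: ladder_inv_def del: fun_upd_apply dom_fun_upd)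
    then show ?thesis unfolding L' n_def by (simp only: add_2_eq_Suc')
  qed
qed simp

lemma
  shows ladder_inj: "inj_on (ladder n t) (dom (ladder n t))"
    and dom_ladder: "dom (ladder n t) \<subseteq> {1..nrows n} \<times> {1..ncols n}"
    and ran_ladder: "ran (ladder n t) = {0} \<union> {2..2 * n + 4}"
proof -
  have "inj_on (ladder n t) (dom (ladder n t)) \<and> dom (ladder n t) \<subseteq> {1..nrows n} \<times> {1..ncols n}
      \<and> ran (ladder n t) = {0} \<union> {2..2 * n + 4}"
  proof (cases "n = 0")
    case True
    have d: "dom (ladder 0 t) = {(1,1),(1,2),(2,1),(2,2)}" by auto
    have "ran (ladder 0 t) = the ` ladder 0 t ` dom (ladder 0 t)" by (rule ran_the_image)
    also have "\<dots> = {0,2,3,4}" unfolding d by simp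
    also have "\<dots> = {0} \<union> {2..4}" by auto
    finally have "ran (ladder 0 t) = {0} \<union> {2..4}" .
    moreover have "inj_on (ladder 0 t) (dom (ladder 0 t))" unfolding d by (simp add: inj_on_def)
    moreover have "dom (ladder 0 t) \<subseteq> {1..2} \<times> {1..2}" unfolding d by auto
    moreover have "nrows 0 = 2" "ncols 0 = 2" by (simp_all add: nrows_def ncols_def)
    ultimately show ?thesis using True by (simp del: ladder.simps)
  next
    case False
    then show ?thesis using ladder_inv_ladder[of n t] by (simp add: ladder_inv_def)
  qed
  then show "inj_on (ladder n t) (dom (ladder n t))"
    "dom (ladder n t) \<subseteq> {1..nrows n} \<times> {1..ncols n}"
    "ran (ladder n t) = {0} \<union> {2..2 * n + 4}" by blast+
qed

datatype vertex = Row nat | Col nat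

text \<open>Every \<open>x\<^sub>j\<close> occurs at exactly one position \<open>(r, c)\<close> (see \<open>ladder_inj\<close>), so the
  union defining the endpoints is just \<open>{Row r, Col c}\<close>.\<close>

definition graph_of_ladder :: "nat \<Rightarrow> bit list \<Rightarrow> (vertex, nat) graph" where
  "graph_of_ladder n t = \<lparr>
     verts = Row ` {1..nrows n} \<union> Col ` {1..ncols n},
     edges = ran (ladder n t),
     ends = (\<lambda>j. \<Union>{{Row r, Col c} | r c. ladder n t (r, c) = Some j})\<rparr>"

end

theory Submission
  imports Defs
begin

text \<open>
  The ladder graph is connected and bipartite with \<open>n + 4\<close> vertices, and the toric ring of a
  connected bipartite graph on a vertex set \<open>V\<close> has dimension \<open>|V| - 1\<close>. The toric ring is
  identified with the algebra generated by the edge monomials \<open>r c\<close> inside the polynomial ring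
  on \<open>V\<close>; the two inequalities are proved separately.

  Upper bound (\<open>krull_dim_toric_ring_le\<close>). A comparison of growth takes the place of
  transcendence degrees. Choose one element from each step of a chain of primes
  \<open>Q\<^sub>0 \<subset> \<dots> \<subset> Q\<^sub>m\<close>, that is, \<open>g\<^sub>i\<close> in \<open>Q\<^sub>i\<^sub>+\<^sub>1\<close> but not in \<open>Q\<^sub>i\<close>. The monomials in \<open>g\<^sub>0, \<dots>, g\<^sub>m\<^sub>-\<^sub>1\<close> are
  linearly independent modulo \<open>Q\<^sub>0\<close> (\<open>prime_chain_independent\<close>), so those with all exponents at
  most \<open>N\<close> span a space of dimension \<open>(N + 1)\<^sup>m\<close>. In every monomial of the toric algebra
  the total degree in the row vertices equals that in the column vertices, so the exponent of one
  row vertex is determined by the others, and at most \<open>(K + 1)\<close> to the power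
  \<open>|V| - 1\<close> such monomials have row degree at most \<open>K\<close> (\<open>finite_card_balanced\<close>). As \<open>K\<close> may
  be taken linear in \<open>N\<close>, letting \<open>N\<close> grow forces \<open>m \<le> |V| - 1\<close>.

  Lower bound (\<open>krull_dim_toric_ring_ge\<close>). Enumerate vertices \<open>w\<^sub>0, \<dots>, w\<^sub>d\<close> so that each one
  after \<open>w\<^sub>0\<close> is joined by an edge to an earlier one. Setting \<open>w\<^sub>0, \<dots>, w\<^sub>i\<close> to \<open>1\<close> maps the
  toric ring to a polynomial ring, hence has a prime kernel \<open>P\<^sub>i\<close>. These kernels increase with \<open>i\<close>,
  and strictly: if the edge \<open>e\<close> joins \<open>w\<^sub>i\<^sub>+\<^sub>1\<close> to an earlier vertex, then \<open>e - 1\<close> lies in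
  \<open>P\<^sub>i\<^sub>+\<^sub>1\<close> but not in \<open>P\<^sub>i\<close>, where \<open>e\<close> still has the value \<open>w\<^sub>i\<^sub>+\<^sub>1\<close>.

  In a ladder all vertices lie on one path, whatever the choices \<open>t\<close>: the positions \<open>(1, 1)\<close> and
  \<open>(1, 2)\<close> followed by the bottom right corners of the successive ladders form a staircase, in
  which consecutive positions share alternately their row and their column.
\<close>

section \<open>Substitution homomorphisms between polynomial rings\<close>

text \<open>Enlarging the index sets of the two sums and products behind \<^const>\<open>subst\<close> to a common
  finite set turns its additivity and multiplicativity into termwise identities.\<close>
lemma prod_powers_superset:
  assumes "finite S" "Poly_Mapping.keys m \<subseteq> S"
  shows "(\<Prod>x\<in>Poly_Mapping.keys m. f x ^ Poly_Mapping.lookup m x)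
    = (\<Prod>x\<in>S. (f x :: 'a::comm_monoid_mult) ^ Poly_Mapping.lookup m x)"
  using assms by (intro prod.mono_neutral_left) (auto simp: in_keys_iff)

lemma prod_powers_add:
  "(\<Prod>x\<in>Poly_Mapping.keys (m + m'). f x ^ Poly_Mapping.lookup (m + m') x)
    = (\<Prod>x\<in>Poly_Mapping.keys m. (f x :: 'a::comm_monoid_mult) ^ Poly_Mapping.lookup m x)
      * (\<Prod>x\<in>Poly_Mapping.keys m'. f x ^ Poly_Mapping.lookup m' x)"
proof -
  let ?S = "Poly_Mapping.keys m \<union> Poly_Mapping.keys m'"
  have "Poly_Mapping.keys (m + m') \<subseteq> ?S" by (rule Poly_Mapping.keys_add)
  then have "(\<Prod>x\<in>Poly_Mapping.keys n. f x ^ Poly_Mapping.lookup n x)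
      = (\<Prod>x\<in>?S. f x ^ Poly_Mapping.lookup n x)" if "n \<in> {m, m', m + m'}" for n
    using that by (intro prod_powers_superset) auto
  then show ?thesis
    by (simp only: insert_iff simp_thms) (simp add: lookup_add power_add prod.distrib)
qed

lemma mconst_simps [simp]:
  "mconst 0 = 0" "mconst 1 = 1"
  "mconst (a + b) = mconst a + mconst b" "mconst (a * b) = mconst a * mconst b"
  "mconst (- a) = - mconst a"
  by (simp_all add: mconst_def single_add mult_single single_uminus)

lemma mconst_mult_single: "mconst a * Poly_Mapping.single m b = Poly_Mapping.single m (a * b)"
  by (simp add: mconst_def mult_single)

lemma sum_monomials:
  fixes p :: "'a \<Rightarrow>\<^sub>0 'b::comm_monoid_add"
  assumes "finite S" "Poly_Mapping.keys p \<subseteq> S"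
  shows "(\<Sum>m\<in>S. Poly_Mapping.single m (Poly_Mapping.lookup p m)) = p"
proof (rule poly_mapping_eqI)
  fix k
  have "Poly_Mapping.lookup (\<Sum>m\<in>S. Poly_Mapping.single m (Poly_Mapping.lookup p m)) k
    = (\<Sum>m\<in>S. if m = k then Poly_Mapping.lookup p m else 0)"
    by (simp add: lookup_sum lookup_single when_def)
  also have "\<dots> = Poly_Mapping.lookup p k"
    using assms by (auto simp: in_keys_iff)
  finally show "Poly_Mapping.lookup (\<Sum>m\<in>S. Poly_Mapping.single m (Poly_Mapping.lookup p m)) k
    = Poly_Mapping.lookup p k" .
qed

lemma subst_superset:
  assumes "finite S" "Poly_Mapping.keys p \<subseteq> S"
  shows "subst f p = (\<Sum>m\<in>S. mconst (Poly_Mapping.lookup p m)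
    * (\<Prod>x\<in>Poly_Mapping.keys m. f x ^ Poly_Mapping.lookup m x))"
  unfolding subst_def using assms by (intro sum.mono_neutral_left) (auto simp: in_keys_iff)

lemma subst_zero [simp]: "subst f 0 = 0"
  by (simp add: subst_def)

lemma subst_single:
  "subst f (Poly_Mapping.single m a)
    = mconst a * (\<Prod>x\<in>Poly_Mapping.keys m. f x ^ Poly_Mapping.lookup m x)"
  by (simp add: subst_superset[of "{m}"])

lemma subst_mconst [simp]: "subst f (mconst a) = mconst a"
  by (simp add: mconst_def[of a] subst_single mconst_mult_single)

lemma subst_one [simp]: "subst f 1 = 1"
  using subst_mconst[of f 1] by simp

lemma subst_mvar [simp]: "subst f (mvar x) = f x"
  by (simp add: mvar_def subst_single)

lemma subst_add: "subst f (p + q) = subst f p + subst f q"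
proof -
  let ?S = "Poly_Mapping.keys p \<union> Poly_Mapping.keys q"
  have "Poly_Mapping.keys (p + q) \<subseteq> ?S" by (rule Poly_Mapping.keys_add)
  then show ?thesis
    by (simp add: subst_superset[of ?S] lookup_add sum.distrib distrib_right)
qed

lemma subst_sum: "subst f (\<Sum>i\<in>I. p i) = (\<Sum>i\<in>I. subst f (p i))"
  by (induction I rule: infinite_finite_induct) (simp_all add: subst_add)

lemma subst_diff: "subst f (p - q) = subst f p - subst f q"
  using subst_add[of f "p - q" q] by (simp add: algebra_simps)

lemma subst_mult: "subst f (p * q) = subst f p * subst f q"
proof -
  let ?m = "\<lambda>p m. Poly_Mapping.single m (Poly_Mapping.lookup p m)"
  have "subst f (p * q) = subst f ((\<Sum>m\<in>Poly_Mapping.keys p. ?m p m) * (\<Sum>m\<in>Poly_Mapping.keys q. ?m q m))"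
    by (simp add: sum_monomials)
  also have "\<dots> = (\<Sum>m\<in>Poly_Mapping.keys p. \<Sum>m'\<in>Poly_Mapping.keys q. subst f (?m p m * ?m q m'))"
    by (simp add: sum_product subst_sum)
  also have "\<dots> = (\<Sum>m\<in>Poly_Mapping.keys p. \<Sum>m'\<in>Poly_Mapping.keys q. subst f (?m p m) * subst f (?m q m'))"
    by (simp add: mult_single subst_single prod_powers_add ac_simps)
  also have "\<dots> = subst f p * subst f q"
    by (simp add: sum_product[symmetric] subst_sum[symmetric] sum_monomials)
  finally show ?thesis .
qed

lemma subst_power: "subst f (p ^ n) = subst f p ^ n"
  by (induction n) (simp_all add: subst_mult)

lemma subst_prod: "subst f (\<Prod>i\<in>I. p i) = (\<Prod>i\<in>I. subst f (p i))"
  by (induction I rule: infinite_finite_induct) (simp_all add: subst_mult)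

lemma subst_subst: "subst f (subst g p) = subst (\<lambda>x. subst f (g x)) p"
  unfolding subst_def[of g] subst_def[of "\<lambda>x. subst f (g x)"]
  by (simp add: subst_sum subst_mult subst_prod subst_power)

text \<open>On \<open>poly_ring A\<close> the operations are those of the type, so that ring identities can be
  handled by ordinary type-class reasoning and only membership in the carrier has to be tracked.\<close>
lemma poly_ring_simps [simp]:
  "carrier (poly_ring A) = {p. \<forall>m\<in>Poly_Mapping.keys p. Poly_Mapping.keys m \<subseteq> A}"
  "monoid.mult (poly_ring A) = (*)" "add (poly_ring A) = (+)" "one (poly_ring A) = 1" "zero (poly_ring A) = 0"
  by (simp_all add: poly_ring_def ring_of_type_algebra_def fun_eq_iff)

lemma keys_uminus [simp]: "Poly_Mapping.keys (- p :: 'a \<Rightarrow>\<^sub>0 'b::ab_group_add) = Poly_Mapping.keys p"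
  by (auto simp: in_keys_iff)

lemma cring_poly_ring: "cring (poly_ring A :: ('x, 'k::field) mpoly ring)" (is "cring ?R")
proof (intro cringI abelian_groupI comm_monoidI)
  fix x y :: "('x, 'k) mpoly" assume "x \<in> carrier ?R" "y \<in> carrier ?R"
  then show "x \<oplus>\<^bsub>?R\<^esub> y \<in> carrier ?R"
    using Poly_Mapping.keys_add[of x y] by auto
next
  fix x y :: "('x, 'k) mpoly" assume xy: "x \<in> carrier ?R" "y \<in> carrier ?R"
  have "Poly_Mapping.keys m \<subseteq> A" if m: "m \<in> Poly_Mapping.keys (x * y)" for m
  proof -
    obtain a b where "m = a + b" "a \<in> Poly_Mapping.keys x" "b \<in> Poly_Mapping.keys y"
      using m keys_mult[of x y] by auto
    then show ?thesis using xy Poly_Mapping.keys_add[of a b] by fastforce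
  qed
  then show "x \<otimes>\<^bsub>?R\<^esub> y \<in> carrier ?R" by simp
next
  fix x :: "('x, 'k) mpoly" assume "x \<in> carrier ?R"
  then show "\<exists>y\<in>carrier ?R. y \<oplus>\<^bsub>?R\<^esub> x = \<zero>\<^bsub>?R\<^esub>"
    by (intro bexI[of _ "- x"]) auto
qed (auto simp: algebra_simps)

lemma mconst_in_poly_ring: "mconst a \<in> carrier (poly_ring A)"
  by (simp add: mconst_def)

lemma mvar_in_poly_ring: "x \<in> A \<Longrightarrow> mvar x \<in> carrier (poly_ring A)"
  by (simp add: mvar_def)

context
  fixes A :: "'x set"
begin

interpretation cring "poly_ring A :: ('x, 'k::field) mpoly ring" by (rule cring_poly_ring)

lemmas poly_ring_closed = a_closed[unfolded poly_ring_simps(2-)] m_closed[unfolded poly_ring_simps(2-)]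
  zero_closed[unfolded poly_ring_simps(2-)] one_closed[unfolded poly_ring_simps(2-)]

end

lemma sum_in_poly_ring:
  "(\<And>i. i \<in> I \<Longrightarrow> p i \<in> carrier (poly_ring A)) \<Longrightarrow> (\<Sum>i\<in>I. p i) \<in> carrier (poly_ring A)"
  by (induction I rule: infinite_finite_induct)
    (simp_all add: poly_ring_closed del: poly_ring_simps(1))

lemma power_in_poly_ring: "p \<in> carrier (poly_ring A) \<Longrightarrow> p ^ n \<in> carrier (poly_ring A)"
  by (induction n) (simp_all add: poly_ring_closed del: poly_ring_simps(1))

lemma prod_in_poly_ring:
  "(\<And>i. i \<in> I \<Longrightarrow> p i \<in> carrier (poly_ring A)) \<Longrightarrow> (\<Prod>i\<in>I. p i) \<in> carrier (poly_ring A)"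
  by (induction I rule: infinite_finite_induct)
    (simp_all add: poly_ring_closed del: poly_ring_simps(1))

lemma subst_in_poly_ring:
  assumes "p \<in> carrier (poly_ring A)" "\<And>x. x \<in> A \<Longrightarrow> f x \<in> carrier (poly_ring B)"
  shows "subst f p \<in> carrier (poly_ring B)"
  unfolding subst_def
proof (intro sum_in_poly_ring poly_ring_closed(2) mconst_in_poly_ring prod_in_poly_ring power_in_poly_ring)
  fix m x assume "m \<in> Poly_Mapping.keys p" "x \<in> Poly_Mapping.keys m"
  then have "x \<in> A" using assms(1) by auto
  then show "f x \<in> carrier (poly_ring B)" by (rule assms(2))
qed

lemma ring_hom_subst:
  assumes "\<And>x. x \<in> A \<Longrightarrow> f x \<in> carrier (poly_ring B)"
  shows "ring_hom_ring (poly_ring A) (poly_ring B) (subst f)"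
  using assms
  by (intro ring_hom_ringI cring.axioms cring_poly_ring)
    (simp_all add: subst_in_poly_ring subst_add subst_mult del: poly_ring_simps(1))

lemma ring_hom_toric_map:
  assumes "\<And>e. e \<in> edges G \<Longrightarrow> ends G e \<subseteq> verts G"
  shows "ring_hom_ring (poly_ring (edges G)) (poly_ring (verts G))
    (toric_map G :: ('e, 'k::field) mpoly \<Rightarrow> ('v, 'k) mpoly)"
  unfolding toric_map_def
  using assms by (intro ring_hom_subst prod_in_poly_ring mvar_in_poly_ring) auto

lemma mem_toric_ideal_iff:
  "p \<in> toric_ideal G \<longleftrightarrow> p \<in> carrier (poly_ring (edges G)) \<and> toric_map G p = 0"
  by (auto simp: toric_ideal_def a_kernel_def')

section \<open>Independence of elements taken along a chain of primes\<close>

lemma primeideal_poly_ringD: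
  fixes Q :: "('x, 'k::field) mpoly set"
  assumes "primeideal Q (poly_ring A)"
  shows "\<And>p. p \<in> Q \<Longrightarrow> p \<in> carrier (poly_ring A)"
    and "\<And>p q. p \<in> Q \<Longrightarrow> q \<in> Q \<Longrightarrow> p + q \<in> Q"
    and "\<And>p q. p \<in> Q \<Longrightarrow> q \<in> carrier (poly_ring A) \<Longrightarrow> q * p \<in> Q"
    and "\<And>p q. p \<in> carrier (poly_ring A) \<Longrightarrow> q \<in> carrier (poly_ring A) \<Longrightarrow> p * q \<in> Q \<Longrightarrow> p \<in> Q \<or> q \<in> Q"
    and "1 \<notin> Q"
proof -
  interpret primeideal Q "poly_ring A" by (rule assms)
  show "p \<in> Q \<Longrightarrow> p \<in> carrier (poly_ring A)" for p by (rule Icarr)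
  show "p \<in> Q \<Longrightarrow> q \<in> Q \<Longrightarrow> p + q \<in> Q" for p q
    using additive_subgroup.a_closed[OF is_additive_subgroup, of p q] by simp
  show "p \<in> Q \<Longrightarrow> q \<in> carrier (poly_ring A) \<Longrightarrow> q * p \<in> Q" for p q
    using I_l_closed[of p q] by (simp del: poly_ring_simps(1))
  show "p \<in> carrier (poly_ring A) \<Longrightarrow> q \<in> carrier (poly_ring A) \<Longrightarrow> p * q \<in> Q \<Longrightarrow> p \<in> Q \<or> q \<in> Q" for p q
    using I_prime[of p q] by (simp del: poly_ring_simps(1))
  show "1 \<notin> Q" using one_imp_carrier I_notcarr by (metis poly_ring_simps(4))
qed

lemma primeideal_powerD:
  fixes Q :: "('x, 'k::field) mpoly set"
  assumes Q: "primeideal Q (poly_ring A)" and p: "p \<in> carrier (poly_ring A)" and "p ^ n \<in> Q"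
  shows "p \<in> Q"
  using assms(3)
proof (induction n)
  case 0
  then show ?case using primeideal_poly_ringD(5)[OF Q] by simp
next
  case (Suc n)
  then show ?case using primeideal_poly_ringD(4)[OF Q p power_in_poly_ring[OF p, of n]] by auto
qed

text \<open>
  Downward induction on \<open>j\<close>. Let \<open>g\<^sub>j\<^sup>k\<close> be the smallest power of \<open>g\<^sub>j\<close> occurring in the
  combination, so that it has the form \<open>g\<^sub>j\<^sup>k (q + g\<^sub>j r)\<close> with \<open>q\<close> a combination of the same kind in
  the later elements only. If it were in \<open>Q\<^sub>j\<close>, then, since \<open>g\<^sub>j \<notin> Q\<^sub>j\<close>, so would be
  \<open>q + g\<^sub>j r\<close>; but \<open>g\<^sub>j \<in> Q\<^sub>j\<^sub>+\<^sub>1\<close>, hence \<open>q \<in> Q\<^sub>j\<^sub>+\<^sub>1\<close>, against the induction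
  hypothesis. At the end of the chain a nonzero constant would lie in a prime ideal.
  Exponent vectors are extensional functions, so that distinct members of \<open>K\<close> are
  distinct exponent vectors.
\<close>
lemma prime_chain_independent:
  fixes Q :: "nat \<Rightarrow> ('x, 'k::field) mpoly set" and c :: "(nat \<Rightarrow> nat) \<Rightarrow> 'k"
  assumes prime: "\<And>i. i \<le> m \<Longrightarrow> primeideal (Q i) (poly_ring A)"
    and sub: "\<And>i. i < m \<Longrightarrow> Q i \<subseteq> Q (Suc i)"
    and g: "\<And>i. i < m \<Longrightarrow> g i \<in> Q (Suc i) - Q i"
    and "j \<le> m" "finite K" "K \<noteq> {}" "K \<subseteq> extensional {j..<m}" "\<And>\<alpha>. \<alpha> \<in> K \<Longrightarrow> c \<alpha> \<noteq> 0"
  shows "(\<Sum>\<alpha>\<in>K. mconst (c \<alpha>) * (\<Prod>i=j..<m. g i ^ \<alpha> i)) \<notin> Q j"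
  using assms(4-)
proof (induction j arbitrary: K c rule: inc_induct)
  case base
  then have "K = {\<lambda>_. undefined}" by auto
  with base have c: "c (\<lambda>_. undefined) \<noteq> 0" by simp
  let ?c = "c (\<lambda>_. undefined)"
  show ?case
  proof
    assume "(\<Sum>\<alpha>\<in>K. mconst (c \<alpha>) * (\<Prod>i=m..<m. g i ^ \<alpha> i)) \<in> Q m"
    then have "mconst ?c \<in> Q m" using \<open>K = _\<close> by simp
    then have "mconst (inverse ?c) * mconst ?c \<in> Q m"
      using primeideal_poly_ringD(3)[OF prime[of m]] mconst_in_poly_ring by blast
    then show False
      using c primeideal_poly_ringD(5)[OF prime[of m]] by (simp flip: mconst_simps(4))
  qed
next
  case (step j K c)
  have j: "j < m" by fact
  note pj = primeideal_poly_ringD[OF prime[OF less_imp_le[OF j]]]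
    and pS = primeideal_poly_ringD[OF prime[OF Suc_leI[OF j]]]
  have gc: "g i \<in> carrier (poly_ring A)" if "i < m" for i
    using primeideal_poly_ringD(1)[OF prime[of "Suc i"]] g[OF that] that by auto
  define k where "k = Min ((\<lambda>\<alpha>. \<alpha> j) ` K)"
  define K1 where "K1 = {\<alpha>\<in>K. \<alpha> j = k}"
  define \<rho> where "\<rho> = (\<lambda>\<alpha>. restrict \<alpha> {Suc j..<m} :: nat \<Rightarrow> nat)"
  define M where "M = (\<lambda>\<alpha>. \<Prod>i=Suc j..<m. g i ^ \<alpha> i)"
  define q where "q = (\<Sum>\<alpha>\<in>K1. mconst (c \<alpha>) * M \<alpha>)"
  define r where "r = (\<Sum>\<alpha>\<in>K-K1. mconst (c \<alpha>) * (g j ^ (\<alpha> j - Suc k) * M \<alpha>))"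
  have kle: "k \<le> \<alpha> j" if "\<alpha> \<in> K" for \<alpha>
    using that step.prems(1) by (simp add: k_def)
  have "k \<in> (\<lambda>\<alpha>. \<alpha> j) ` K" unfolding k_def using step.prems by (intro Min_in) auto
  then have K1: "K1 \<noteq> {}" "finite K1" "K1 \<subseteq> K" using step.prems by (auto simp: K1_def)
  have Mc: "M \<alpha> \<in> carrier (poly_ring A)" for \<alpha>
    unfolding M_def by (intro prod_in_poly_ring power_in_poly_ring gc) auto
  have qc: "q \<in> carrier (poly_ring A)" and rc: "r \<in> carrier (poly_ring A)"
    unfolding q_def r_def
    by (intro sum_in_poly_ring poly_ring_closed(2) mconst_in_poly_ring power_in_poly_ring gc Mc j)+
  have "(\<Sum>\<alpha>\<in>K. mconst (c \<alpha>) * (\<Prod>i=j..<m. g i ^ \<alpha> i))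
    = (\<Sum>\<alpha>\<in>K. mconst (c \<alpha>) * (g j ^ \<alpha> j * M \<alpha>))"
    using j by (simp add: prod.atLeast_Suc_lessThan M_def)
  also have "\<dots> = (\<Sum>\<alpha>\<in>K1. mconst (c \<alpha>) * (g j ^ \<alpha> j * M \<alpha>))
      + (\<Sum>\<alpha>\<in>K-K1. mconst (c \<alpha>) * (g j ^ \<alpha> j * M \<alpha>))"
    using sum.subset_diff[OF K1(3) step.prems(1)] by (simp add: add.commute)
  also have "(\<Sum>\<alpha>\<in>K1. mconst (c \<alpha>) * (g j ^ \<alpha> j * M \<alpha>)) = g j ^ k * q"
    by (simp add: q_def sum_distrib_left K1_def ac_simps)
  also have "(\<Sum>\<alpha>\<in>K-K1. mconst (c \<alpha>) * (g j ^ \<alpha> j * M \<alpha>)) = g j ^ k * (g j * r)"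
    unfolding r_def sum_distrib_left
  proof (rule sum.cong[OF refl])
    fix \<alpha> assume "\<alpha> \<in> K - K1"
    then have "k < \<alpha> j" using kle[of \<alpha>] by (auto simp: K1_def)
    then have "g j ^ \<alpha> j = g j ^ k * (g j * g j ^ (\<alpha> j - Suc k))"
      by (metis power_add power_Suc Suc_diff_Suc le_add_diff_inverse less_imp_le)
    then show "mconst (c \<alpha>) * (g j ^ \<alpha> j * M \<alpha>)
        = g j ^ k * (g j * (mconst (c \<alpha>) * (g j ^ (\<alpha> j - Suc k) * M \<alpha>)))"
      by (simp add: ac_simps)
  qed
  finally have eq: "(\<Sum>\<alpha>\<in>K. mconst (c \<alpha>) * (\<Prod>i=j..<m. g i ^ \<alpha> i)) = g j ^ k * (q + g j * r)"
    by (simp add: distrib_left)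
  \<comment> \<open>All exponents in \<open>K1\<close> agree at \<open>j\<close>, so distinct ones remain distinct after \<open>j\<close> is dropped;
    otherwise terms of \<open>q\<close> could cancel.\<close>
  have inj: "inj_on \<rho> K1"
  proof
    fix \<alpha> \<beta> assume ab: "\<alpha> \<in> K1" "\<beta> \<in> K1" "\<rho> \<alpha> = \<rho> \<beta>"
    show "\<alpha> = \<beta>"
    proof (rule extensionalityI[where A = "{j..<m}"])
      show "\<alpha> \<in> extensional {j..<m}" "\<beta> \<in> extensional {j..<m}" using ab K1 step.prems by auto
      fix i assume i: "i \<in> {j..<m}"
      show "\<alpha> i = \<beta> i"
      proof (cases "i = j")
        case True
        then show ?thesis using ab by (simp add: K1_def)
      next
        case False
        then have "i \<in> {Suc j..<m}" using i by auto
        then show ?thesis using fun_cong[OF ab(3), of i] by (simp add: \<rho>_def)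
      qed
    qed
  qed
  have "q = (\<Sum>\<beta>\<in>\<rho> ` K1. mconst (c (inv_into K1 \<rho> \<beta>)) * (\<Prod>i=Suc j..<m. g i ^ \<beta> i))"
    unfolding sum.reindex[OF inj] q_def
  proof (rule sum.cong[OF refl])
    fix \<alpha> assume "\<alpha> \<in> K1"
    then have "inv_into K1 \<rho> (\<rho> \<alpha>) = \<alpha>" using inj by simp
    then show "mconst (c \<alpha>) * M \<alpha> = ((\<lambda>\<beta>. mconst (c (inv_into K1 \<rho> \<beta>))
        * (\<Prod>i=Suc j..<m. g i ^ \<beta> i)) \<circ> \<rho>) \<alpha>"
      by (simp add: M_def) (simp add: \<rho>_def)
  qed
  also have "\<dots> \<notin> Q (Suc j)"
  proof (rule step.IH)
    show "\<rho> ` K1 \<subseteq> extensional {Suc j..<m}" by (auto simp: \<rho>_def)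
    show "c (inv_into K1 \<rho> \<beta>) \<noteq> 0" if "\<beta> \<in> \<rho> ` K1" for \<beta>
      using that K1(3) step.prems(4) inv_into_into[of \<beta> \<rho> K1] by auto
  qed (use K1 in auto)
  finally have q: "q \<notin> Q (Suc j)" .
  show ?case
  proof
    assume "(\<Sum>\<alpha>\<in>K. mconst (c \<alpha>) * (\<Prod>i=j..<m. g i ^ \<alpha> i)) \<in> Q j"
    then have "g j ^ k * (q + g j * r) \<in> Q j" by (simp add: eq)
    then have "g j ^ k \<in> Q j \<or> q + g j * r \<in> Q j"
      by (intro pj(4) power_in_poly_ring poly_ring_closed gc[OF j] qc rc)
    moreover have "g j ^ k \<notin> Q j"
      using primeideal_powerD[OF prime[of j] gc[of j]] g[of j] j by auto
    ultimately have "q + g j * r \<in> Q (Suc j)" using sub[OF j] by blast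
    moreover have "mconst (- 1) * (r * g j) \<in> Q (Suc j)"
      using g[OF j] rc by (intro pS(3) mconst_in_poly_ring) auto
    ultimately have "(q + g j * r) + mconst (- 1) * (r * g j) \<in> Q (Suc j)"
      by (rule pS(2))
    then show False using q by (simp add: ac_simps)
  qed
qed

section \<open>Growth of the toric ring of a bipartite graph\<close>

text \<open>The \<open>u \<alpha>\<close> are independent vectors in the span of the \<open>card T\<close> monomials in \<open>T\<close>. Allowing only nonzero
  coefficients in the hypothesis matches the form in which independence is obtained from a chain of
  primes.\<close>
lemma card_le_of_independent_family:
  fixes u :: "'i \<Rightarrow> ('x, 'k::field) mpoly"
  assumes fin: "finite T" and u: "\<And>\<alpha>. \<alpha> \<in> I \<Longrightarrow> Poly_Mapping.keys (u \<alpha>) \<subseteq> T"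
    and indep: "\<And>K c. K \<subseteq> I \<Longrightarrow> finite K \<Longrightarrow> K \<noteq> {} \<Longrightarrow> (\<And>\<alpha>. \<alpha> \<in> K \<Longrightarrow> c \<alpha> \<noteq> 0)
      \<Longrightarrow> (\<Sum>\<alpha>\<in>K. mconst (c \<alpha>) * u \<alpha>) \<noteq> 0"
  shows "card I \<le> card T"
proof -
  interpret vector_space "\<lambda>(a::'k) (p::('x, 'k) mpoly). mconst a * p"
    by unfold_locales (simp_all add: algebra_simps)
  have inj: "inj_on u I"
  proof (rule inj_onI, rule ccontr)
    fix \<alpha> \<beta> assume "\<alpha> \<in> I" "\<beta> \<in> I" "u \<alpha> = u \<beta>" "\<alpha> \<noteq> \<beta>"
    moreover from this have
      "(\<Sum>\<gamma>\<in>{\<alpha>, \<beta>}. mconst (if \<gamma> = \<alpha> then 1 else - 1) * u \<gamma>) \<noteq> 0"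
      by (intro indep) auto
    ultimately show False by simp
  qed
  have "independent (u ` I)"
    unfolding independent_explicit_finite_subsets
  proof (intro allI impI ballI)
    fix S a p
    assume S: "S \<subseteq> u ` I" "finite S" and zero: "(\<Sum>v\<in>S. mconst (a v) * v) = 0" and p: "p \<in> S"
    obtain K where K: "K \<subseteq> I" "finite K" "S = u ` K"
      using S by (meson finite_subset_image)
    let ?K = "{\<alpha>\<in>K. a (u \<alpha>) \<noteq> 0}"
    have "(\<Sum>v\<in>S. mconst (a v) * v) = (\<Sum>\<alpha>\<in>K. mconst (a (u \<alpha>)) * u \<alpha>)"
      unfolding K(3) by (simp add: sum.reindex[OF inj_on_subset[OF inj K(1)]])
    also have "\<dots> = (\<Sum>\<alpha>\<in>?K. mconst (a (u \<alpha>)) * u \<alpha>)"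
      using K(2) by (intro sum.mono_neutral_right) auto
    finally have "(\<Sum>\<alpha>\<in>?K. mconst (a (u \<alpha>)) * u \<alpha>) = 0" using zero by simp
    moreover have "(\<Sum>\<alpha>\<in>?K. mconst (a (u \<alpha>)) * u \<alpha>) \<noteq> 0" if "?K \<noteq> {}"
      by (rule indep[OF _ _ that]) (use K in auto)
    ultimately have "?K = {}" by blast
    then show "a p = 0" using p K(3) by auto
  qed
  moreover have "u ` I \<subseteq> span ((\<lambda>m. Poly_Mapping.single m 1) ` T)"
  proof
    fix p assume "p \<in> u ` I"
    then have "p = (\<Sum>m\<in>T. mconst (Poly_Mapping.lookup p m) * Poly_Mapping.single m 1)"
      using sum_monomials[OF fin, of p] u by (auto simp: mconst_mult_single)
    also have "\<dots> \<in> span ((\<lambda>m. Poly_Mapping.single m 1) ` T)"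
      by (intro span_sum span_scale span_base) auto
    finally show "p \<in> span ((\<lambda>m. Poly_Mapping.single m 1) ` T)" .
  qed
  ultimately have "card (u ` I) \<le> card ((\<lambda>m. Poly_Mapping.single m (1::'k)) ` T)"
    using independent_span_bound fin by blast
  also have "\<dots> \<le> card T" by (rule card_image_le[OF fin])
  finally show ?thesis by (simp add: card_image[OF inj])
qed

text \<open>The exponents of the monomials in the toric algebra of a bipartite graph with sides \<open>R\<close> and
  \<open>C\<close> belong to these sets: a product of \<open>l\<close> edges has degree \<open>l\<close> in each side.\<close>
definition balanced :: "'v set \<Rightarrow> 'v set \<Rightarrow> nat \<Rightarrow> ('v \<Rightarrow>\<^sub>0 nat) set" where
  "balanced R C K = {m. Poly_Mapping.keys m \<subseteq> R \<union> C
     \<and> sum (Poly_Mapping.lookup m) R = sum (Poly_Mapping.lookup m) C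
     \<and> sum (Poly_Mapping.lookup m) R \<le> K}"

lemma balanced_mono: "K \<le> L \<Longrightarrow> balanced R C K \<subseteq> balanced R C L"
  by (auto simp: balanced_def)

lemma zero_balanced: "0 \<in> balanced R C K"
  by (simp add: balanced_def)

lemma balanced_add:
  assumes "a \<in> balanced R C K" "b \<in> balanced R C L"
  shows "a + b \<in> balanced R C (K + L)"
  using assms Poly_Mapping.keys_add[of a b] by (fastforce simp: balanced_def lookup_add sum.distrib)

text \<open>Fix \<open>v \<in> R\<close>. All exponents are at most \<open>K\<close>, and the exponent of \<open>v\<close> is the degree in \<open>C\<close> minus
  the sum of the exponents of the other members of \<open>R\<close>. This loss of one degree of freedom is what makes the
  dimension \<open>|V| - 1\<close> instead of \<open>|V|\<close>.\<close>
lemma finite_card_balanced: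
  assumes fin: "finite R" "finite C" and disj: "R \<inter> C = {}" and ne: "R \<noteq> {}"
  shows "finite (balanced R C K)" "card (balanced R C K) \<le> (K + 1) ^ (card (R \<union> C) - 1)"
proof -
  obtain v where v: "v \<in> R" using ne by blast
  let ?M = "balanced R C K" and ?V = "R \<union> C - {v}"
  let ?F = "?V \<rightarrow>\<^sub>E {..K}" and ?\<rho> = "\<lambda>m. restrict (Poly_Mapping.lookup m) ?V"
  have "?\<rho> ` ?M \<subseteq> ?F"
  proof (rule image_subsetI)
    fix m assume m: "m \<in> ?M"
    have "Poly_Mapping.lookup m x \<le> K" if "x \<in> R \<union> C" for x
    proof -
      have "Poly_Mapping.lookup m x \<le> sum (Poly_Mapping.lookup m) R \<or>
        Poly_Mapping.lookup m x \<le> sum (Poly_Mapping.lookup m) C"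
        using that fin by (auto intro: member_le_sum)
      then show ?thesis using m by (auto simp: balanced_def)
    qed
    then show "?\<rho> m \<in> ?F" by auto
  qed
  moreover have "inj_on ?\<rho> ?M"
  proof
    fix a b assume ab: "a \<in> ?M" "b \<in> ?M" "?\<rho> a = ?\<rho> b"
    have V: "Poly_Mapping.lookup a x = Poly_Mapping.lookup b x" if "x \<in> ?V" for x
      using fun_cong[OF ab(3), of x] that by auto
    have "sum (Poly_Mapping.lookup a) C = sum (Poly_Mapping.lookup b) C"
      using disj v by (intro sum.cong refl V) auto
    moreover have "sum (Poly_Mapping.lookup a) (R - {v}) = sum (Poly_Mapping.lookup b) (R - {v})"
      by (intro sum.cong refl V) auto
    ultimately have "Poly_Mapping.lookup a v = Poly_Mapping.lookup b v"
      using ab(1,2) sum.remove[OF fin(1) v, of "Poly_Mapping.lookup a"]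
        sum.remove[OF fin(1) v, of "Poly_Mapping.lookup b"] by (simp add: balanced_def)
    moreover have "Poly_Mapping.lookup a x = 0 \<and> Poly_Mapping.lookup b x = 0" if "x \<notin> R \<union> C" for x
      using ab(1,2) that by (auto simp: balanced_def in_keys_iff subset_iff)
    ultimately show "a = b" using V by (intro poly_mapping_eqI) (metis Diff_iff singletonD)
  qed
  moreover have "finite ?F" using fin by (intro finite_PiE) auto
  ultimately show "finite ?M" "card ?M \<le> (K + 1) ^ (card (R \<union> C) - 1)"
    using inj_on_finite[of ?\<rho> ?M ?F] card_inj_on_le[of ?\<rho> ?M ?F] fin v
    by (auto simp: card_PiE card_Diff_singleton)
qed

lemma keys_mult_balanced:
  assumes "Poly_Mapping.keys p \<subseteq> balanced R C K" "Poly_Mapping.keys q \<subseteq> balanced R C L"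
  shows "Poly_Mapping.keys (p * q) \<subseteq> balanced R C (K + L)"
  using keys_mult[of p q] assms balanced_add by fastforce

lemma keys_power_balanced:
  assumes "Poly_Mapping.keys (p :: ('v, 'k::field) mpoly) \<subseteq> balanced R C K"
  shows "Poly_Mapping.keys (p ^ n) \<subseteq> balanced R C (n * K)"
proof (induction n)
  case 0
  then show ?case by (simp add: zero_balanced)
next
  case (Suc n)
  then show ?case using keys_mult_balanced[OF assms, of "p ^ n" "n * K"] by simp
qed

lemma keys_prod_balanced:
  assumes "\<And>i. i \<in> I \<Longrightarrow> Poly_Mapping.keys (p i :: ('v, 'k::field) mpoly) \<subseteq> balanced R C (K i)"
  shows "Poly_Mapping.keys (\<Prod>i\<in>I. p i) \<subseteq> balanced R C (\<Sum>i\<in>I. K i)"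
  using assms
proof (induction I rule: infinite_finite_induct)
  case (insert i I)
  then show ?case using keys_mult_balanced[of "p i" R C "K i" "prod p I" "sum K I"] by auto
qed (simp_all add: zero_balanced)

lemma keys_edge_balanced:
  assumes "finite R" "finite C" "R \<inter> C = {}" "x \<in> R" "y \<in> C"
  shows "Poly_Mapping.keys (\<Prod>v\<in>{x, y}. mvar v :: ('v, 'k::field) mpoly) \<subseteq> balanced R C 1"
proof -
  let ?m = "Poly_Mapping.single x 1 + Poly_Mapping.single y (1::nat)"
  have "x \<noteq> y" using assms by auto
  then have "(\<Prod>v\<in>{x, y}. mvar v :: ('v, 'k) mpoly) = Poly_Mapping.single ?m 1"
    by (simp add: mvar_def mult_single)
  moreover have "sum (Poly_Mapping.lookup ?m) R = 1" "sum (Poly_Mapping.lookup ?m) C = 1"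
    using assms by (auto simp: lookup_add lookup_single when_def sum.distrib disjoint_iff
        cong: if_cong)
  moreover have "Poly_Mapping.keys ?m \<subseteq> R \<union> C"
    using Poly_Mapping.keys_add[of "Poly_Mapping.single x 1" "Poly_Mapping.single y (1::nat)"] assms by auto
  ultimately show ?thesis by (simp add: balanced_def)
qed

lemma keys_toric_map_balanced:
  fixes G :: "('v, 'e) graph" and p :: "('e, 'k::field) mpoly"
  assumes fin: "finite R" "finite C" "R \<inter> C = {}"
    and ends: "\<And>e. e \<in> edges G \<Longrightarrow> \<exists>x\<in>R. \<exists>y\<in>C. ends G e = {x, y}"
    and p: "p \<in> carrier (poly_ring (edges G))"
  shows "\<exists>K. Poly_Mapping.keys (toric_map G p) \<subseteq> balanced R C K"
proof -
  let ?mon = "\<lambda>m. \<Prod>e\<in>Poly_Mapping.keys m. (\<Prod>v\<in>ends G e. mvar v :: ('v, 'k) mpoly) ^ Poly_Mapping.lookup m e"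
  \<comment> \<open>The factor \<open>1\<close> is the degree of a single edge.\<close>
  let ?deg = "\<lambda>m. \<Sum>e\<in>Poly_Mapping.keys m. Poly_Mapping.lookup m e * 1"
  let ?K = "\<Sum>m\<in>Poly_Mapping.keys p. ?deg m"
  have "Poly_Mapping.keys (mconst a * ?mon m) \<subseteq> balanced R C ?K" if m: "m \<in> Poly_Mapping.keys p" for a m
  proof -
    have "Poly_Mapping.keys (?mon m) \<subseteq> balanced R C (?deg m)"
    proof (intro keys_prod_balanced keys_power_balanced)
      fix e assume "e \<in> Poly_Mapping.keys m"
      then have "e \<in> edges G" using p m by auto
      then obtain x y where "x \<in> R" "y \<in> C" "ends G e = {x, y}" using ends by blast
      then show "Poly_Mapping.keys (\<Prod>v\<in>ends G e. mvar v :: ('v, 'k) mpoly) \<subseteq> balanced R C 1"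
        using keys_edge_balanced[OF fin] by metis
    qed
    moreover have "Poly_Mapping.keys (mconst a :: ('v, 'k) mpoly) \<subseteq> balanced R C 0"
      by (simp add: mconst_def zero_balanced)
    ultimately have "Poly_Mapping.keys (mconst a * ?mon m) \<subseteq> balanced R C (0 + ?deg m)"
      by (intro keys_mult_balanced)
    also have "\<dots> \<subseteq> balanced R C ?K"
      using m member_le_sum[of m "Poly_Mapping.keys p" ?deg] by (intro balanced_mono) simp
    finally show ?thesis .
  qed
  then have "Poly_Mapping.keys (toric_map G p) \<subseteq> balanced R C ?K"
    unfolding toric_map_def subst_def by (intro order_trans[OF keys_sum] UN_least)
  then show ?thesis ..
qed

text \<open>Otherwise \<open>(N + 1)\<close> to the power \<open>d + 1\<close> would be at most a constant times
  \<open>(N + 1)\<^sup>d\<close>, which fails once \<open>N\<close> is that constant, here \<open>(m D + 1)\<^sup>d\<close>.\<close>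
lemma power_outgrows:
  fixes d m D :: nat
  assumes "\<And>N. (N + 1) ^ m \<le> (m * N * D + 1) ^ d"
  shows "m \<le> d"
proof (rule ccontr)
  assume "\<not> m \<le> d"
  define N where "N = (m * D + 1) ^ d"
  have "(N + 1) ^ d * (N + 1) = (N + 1) ^ Suc d" by simp
  also have "\<dots> \<le> (N + 1) ^ m" using \<open>\<not> m \<le> d\<close> by (intro power_increasing) auto
  also have "\<dots> \<le> (m * N * D + 1) ^ d" by (rule assms)
  also have "\<dots> \<le> ((N + 1) * (m * D + 1)) ^ d" by (intro power_mono) (auto simp: algebra_simps)
  also have "\<dots> = (N + 1) ^ d * N" by (simp only: power_mult_distrib N_def[symmetric])
  finally show False by simp
qed

text \<open>A chain of primes of the toric ring is pulled back to the polynomial ring on the edges, where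
  the independent monomials are formed; the toric map then carries them to independent polynomials
  with balanced exponents, because its kernel is contained in the smallest prime of the pulled back
  chain.\<close>
theorem krull_dim_toric_ring_le:
  fixes G :: "('v, 'e) graph"
  assumes fin: "finite R" "finite C" and disj: "R \<inter> C = {}" and ne: "R \<noteq> {}" and V: "verts G = R \<union> C"
    and ends: "\<And>e. e \<in> edges G \<Longrightarrow> \<exists>r\<in>R. \<exists>c\<in>C. ends G e = {r, c}"
  shows "krull_dim (toric_ring G :: ('e, 'k::field) mpoly set ring) \<le> enat (card (verts G) - 1)"
proof -
  let ?A = "poly_ring (edges G) :: ('e, 'k) mpoly ring"
  let ?I = "toric_ideal G :: ('e, 'k) mpoly set"
  let ?T = "toric_ring G :: ('e, 'k) mpoly set ring"
  let ?d = "card (verts G) - 1"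
  have hom: "ring_hom_ring ?A (poly_ring (verts G)) (toric_map G :: _ \<Rightarrow> ('v, 'k) mpoly)"
    by (rule ring_hom_toric_map) (use ends V in fastforce)
  have I: "ideal ?I ?A"
    unfolding toric_ideal_def by (rule ring_hom_ring.kernel_is_ideal[OF hom])
  have abel: "abelian_group ?A"
    by (intro ring.is_abelian_group cring.axioms(1) cring_poly_ring)
  have quot: "ring_hom_ring ?A ?T ((+>\<^bsub>?A\<^esub>) ?I)"
    unfolding toric_ring_def by (rule ideal.rcos_ring_hom_ring[OF I])
  have surj: "\<exists>p\<in>carrier ?A. Z = ?I +>\<^bsub>?A\<^esub> p" if "Z \<in> carrier ?T" for Z
    using that by (auto simp: toric_ring_def FactRing_def A_RCOSETS_def' simp del: poly_ring_simps)
  have bound: "m \<le> ?d" if prime: "\<And>i. i \<le> m \<Longrightarrow> primeideal (P i) ?T" and strict: "\<And>i. i < m \<Longrightarrow> P i \<subset> P (Suc i)" for m P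
  proof -
    define Q where "Q i = {p \<in> carrier ?A. ?I +>\<^bsub>?A\<^esub> p \<in> P i}" for i
    have primeQ: "primeideal (Q i) ?A" if "i \<le> m" for i
      unfolding Q_def by (rule ring_hom_ring.primeideal_vimage[OF quot cring_poly_ring prime[OF that]])
    have "\<exists>p. p \<in> Q (Suc i) - Q i" if i: "i < m" for i
    proof -
      obtain Z where Z: "Z \<in> P (Suc i)" "Z \<notin> P i" using strict[OF i] by blast
      have "Z \<in> carrier ?T"
        using ideal.Icarr[OF primeideal.axioms(1)[OF prime[OF Suc_leI[OF i]]] Z(1)] .
      with surj Z show ?thesis unfolding Q_def by blast
    qed
    then obtain g where g: "g i \<in> Q (Suc i) - Q i" if "i < m" for i by metis
    have subQ: "Q i \<subseteq> Q (Suc i)" if "i < m" for i using strict[OF that] by (auto simp: Q_def)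
    have gc: "g i \<in> carrier ?A" if "i < m" for i using g[OF that] unfolding Q_def by blast
    have "\<exists>D. Poly_Mapping.keys (toric_map G p :: ('v, 'k) mpoly) \<subseteq> balanced R C D"
      if "p \<in> carrier ?A" for p using keys_toric_map_balanced[OF fin disj ends that] .
    then have "\<exists>D. i < m \<longrightarrow> Poly_Mapping.keys (toric_map G (g i) :: ('v, 'k) mpoly) \<subseteq> balanced R C D" for i
      using gc[of i] by blast
    then obtain D' where D': "Poly_Mapping.keys (toric_map G (g i) :: ('v, 'k) mpoly) \<subseteq> balanced R C (D' i)"
      if "i < m" for i by metis
    \<comment> \<open>A common bound for the degrees of the images of all \<open>g i\<close>.\<close>
    define D where "D = (\<Sum>i<m. D' i)"
    have D: "Poly_Mapping.keys (toric_map G (g i) :: ('v, 'k) mpoly) \<subseteq> balanced R C D" if "i < m" for i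
      using D'[OF that] balanced_mono[of "D' i" D R C] that member_le_sum[of i "{..<m}" D']
      by (auto simp: D_def)
    have I_sub: "?I \<subseteq> Q 0"
    proof
      fix p assume p: "p \<in> ?I"
      then have "?I +>\<^bsub>?A\<^esub> p = \<zero>\<^bsub>?T\<^esub>"
        using abelian_subgroup.a_rcos_const[OF abelian_subgroupI3[OF ideal.axioms(1)[OF I] abel]]
        by (simp add: toric_ring_def FactRing_def)
      moreover have "\<zero>\<^bsub>?T\<^esub> \<in> P 0"
        by (intro additive_subgroup.zero_closed ideal.axioms(1) primeideal.axioms(1) prime) simp
      ultimately show "p \<in> Q 0" using p by (simp add: Q_def mem_toric_ideal_iff)
    qed
    have "(N + 1) ^ m \<le> (m * N * D + 1) ^ ?d" for N
    proof -
      let ?F = "{0..<m} \<rightarrow>\<^sub>E {..N}"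
      let ?u = "\<lambda>\<alpha>. \<Prod>i=0..<m. (toric_map G (g i) :: ('v, 'k) mpoly) ^ \<alpha> i"
      have "card ?F \<le> card (balanced R C (m * N * D))"
      proof (rule card_le_of_independent_family[where u = ?u])
        fix \<alpha> assume \<alpha>: "\<alpha> \<in> ?F"
        have "Poly_Mapping.keys (?u \<alpha>) \<subseteq> balanced R C (\<Sum>i=0..<m. \<alpha> i * D)"
          by (intro keys_prod_balanced keys_power_balanced D) simp
        also have "\<dots> \<subseteq> balanced R C (m * N * D)"
        proof (rule balanced_mono)
          have "(\<Sum>i=0..<m. \<alpha> i * D) \<le> (\<Sum>i=0..<m. N * D)"
            using \<alpha> by (intro sum_mono mult_right_mono) (auto simp: PiE_iff)
          then show "(\<Sum>i=0..<m. \<alpha> i * D) \<le> m * N * D" by simp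
        qed
        finally show "Poly_Mapping.keys (?u \<alpha>) \<subseteq> balanced R C (m * N * D)" .
      next
        fix K and c :: "(nat \<Rightarrow> nat) \<Rightarrow> 'k"
        assume K: "K \<subseteq> ?F" "finite K" "K \<noteq> {}" and c: "\<And>\<alpha>. \<alpha> \<in> K \<Longrightarrow> c \<alpha> \<noteq> 0"
        let ?s = "\<Sum>\<alpha>\<in>K. mconst (c \<alpha>) * (\<Prod>i=0..<m. g i ^ \<alpha> i)"
        have "?s \<notin> Q 0"
        proof (rule prime_chain_independent[where m = m and Q = Q and g = g])
          show "K \<subseteq> extensional {0..<m}" using K(1) by (auto simp: PiE_def)
        qed (use primeQ subQ g K c in simp_all)
        moreover have "?s \<in> carrier ?A"
          by (intro sum_in_poly_ring poly_ring_closed(2) mconst_in_poly_ring prod_in_poly_ring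
              power_in_poly_ring gc) auto
        ultimately have "toric_map G ?s \<noteq> (0 :: ('v, 'k) mpoly)"
          using I_sub by (auto simp: mem_toric_ideal_iff simp del: poly_ring_simps)
        then show "(\<Sum>\<alpha>\<in>K. mconst (c \<alpha>) * ?u \<alpha>) \<noteq> 0"
          by (simp add: toric_map_def subst_sum subst_mult subst_prod subst_power)
      qed (rule finite_card_balanced[OF fin disj ne])
      also have "\<dots> \<le> (m * N * D + 1) ^ ?d"
        unfolding V by (rule finite_card_balanced[OF fin disj ne])
      finally show ?thesis by (simp add: card_PiE)
    qed
    then show "m \<le> ?d" by (rule power_outgrows)
  qed
  show ?thesis
    unfolding krull_dim_def
  proof (rule Sup_least)
    fix x assume "x \<in> {enat m |m. \<exists>P. (\<forall>i\<le>m. primeideal (P i) ?T) \<and> (\<forall>i<m. P i \<subset> P (Suc i))}"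
    then obtain m P where "x = enat m" "\<And>i. i \<le> m \<Longrightarrow> primeideal (P i) ?T"
      "\<And>i. i < m \<Longrightarrow> P i \<subset> P (Suc i)" by blast
    then show "x \<le> enat ?d" using bound[of m P] by simp
  qed
qed

section \<open>A chain of primes along an enumeration of the vertices\<close>

text \<open>The order on the variables serves to compare leading monomials. The specialisations below
  therefore take values in polynomials with variables indexed by natural numbers.\<close>
lemma domain_poly_ring:
  "domain (poly_ring A :: ('x::linorder, 'k::field) mpoly ring)"
  by (intro domain.intro domain_axioms.intro cring_poly_ring) auto

text \<open>The prime \<open>P i\<close> is the kernel of \<open>\<phi> i\<close>, which reads an element of the toric ring as a polynomial in the
  vertices and then sets \<open>w 0, \<dots>, w i\<close> to \<open>1\<close>, replacing each later \<open>w l\<close> by the variable with index \<open>l\<close>.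
  Vertices outside the enumeration, where the inverse of \<open>w\<close> is arbitrary, are sent to \<open>1\<close> throughout.\<close>
theorem krull_dim_toric_ring_ge:
  fixes G :: "('v, 'e) graph" and w :: "nat \<Rightarrow> 'v"
  assumes ends: "\<And>e. e \<in> edges G \<Longrightarrow> ends G e \<subseteq> verts G"
    and inj: "inj_on w {..d}"
    and conn: "\<And>i. i < d \<Longrightarrow> \<exists>e\<in>edges G. \<exists>j\<le>i. ends G e = {w j, w (Suc i)}"
  shows "enat d \<le> krull_dim (toric_ring G :: ('e, 'k::field) mpoly set ring)"
proof -
  let ?A = "poly_ring (edges G) :: ('e, 'k) mpoly ring"
  let ?B = "poly_ring (verts G) :: ('v, 'k) mpoly ring"
  let ?S = "poly_ring UNIV :: (nat, 'k) mpoly ring"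
  let ?I = "toric_ideal G :: ('e, 'k) mpoly set"
  let ?T = "toric_ring G :: ('e, 'k) mpoly set ring"
  let ?\<tau> = "toric_map G :: ('e, 'k) mpoly \<Rightarrow> ('v, 'k) mpoly"
  define \<theta> :: "nat \<Rightarrow> ('v, 'k) mpoly \<Rightarrow> (nat, 'k) mpoly" where
    "\<theta> i = subst (\<lambda>v. if v \<in> w ` {i<..d} then mvar (inv_into {..d} w v) else 1)" for i
  define \<phi> :: "nat \<Rightarrow> ('e, 'k) mpoly set \<Rightarrow> (nat, 'k) mpoly" where
    "\<phi> i = \<theta> i \<circ> (\<lambda>Z. the_elem (?\<tau> ` Z))" for i
  \<comment> \<open>The zero ideal of a domain is prime, and preimages of primes are prime.\<close>
  define P where "P i = {Z \<in> carrier ?T. \<phi> i Z \<in> {\<zero>\<^bsub>?S\<^esub>}}" for i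
  have \<tau>: "ring_hom_ring ?A ?B ?\<tau>" by (rule ring_hom_toric_map[OF ends])
  have I: "ideal ?I ?A"
    unfolding toric_ideal_def by (rule ring_hom_ring.kernel_is_ideal[OF \<tau>])
  have T: "cring ?T"
    unfolding toric_ring_def by (rule ideal.quotient_is_cring[OF I cring_poly_ring])
  have \<phi>: "ring_hom_ring ?T ?S (\<phi> i)" for i
  proof (rule ring_hom_ringI2)
    show "ring ?T" "ring ?S" using T cring_poly_ring by (auto intro: cring.axioms)
    have "ring_hom_ring ?B ?S (\<theta> i)" unfolding \<theta>_def by (rule ring_hom_subst) simp
    then show "\<phi> i \<in> ring_hom ?T ?S"
      unfolding \<phi>_def toric_ring_def toric_ideal_def
      by (intro ring_hom_trans[OF ring_hom_ring.the_elem_hom[OF \<tau>]] ring_hom_ring.homh)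
  qed
  have prime: "primeideal (P i) ?T" for i
    unfolding P_def
    by (rule ring_hom_ring.primeideal_vimage[OF \<phi> T domain.zeroprimeideal[OF domain_poly_ring]])
  have strict: "P i \<subset> P (Suc i)" if i: "i < d" for i
  proof
    let ?\<sigma> = "subst (\<lambda>j. if j = Suc i then 1 else mvar j) :: (nat, 'k) mpoly \<Rightarrow> (nat, 'k) mpoly"
    have idx: "inv_into {..d} w (w l) = l" if "l \<le> d" for l
      using that inj by simp
    have mem: "w l \<in> w ` {a<..d} \<longleftrightarrow> a < l" if "l \<le> d" for l a
      by (subst inj_on_image_mem_iff[OF inj]) (use that in auto)
    \<comment> \<open>The next specialisation factors through the present one, so its kernel is at least as large.\<close>
    have "\<theta> (Suc i) p = ?\<sigma> (\<theta> i p)" for p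
    proof -
      have "(if v \<in> w ` {Suc i<..d} then mvar (inv_into {..d} w v) else 1)
        = ?\<sigma> (if v \<in> w ` {i<..d} then mvar (inv_into {..d} w v) else 1)" for v
      proof (cases "v \<in> w ` {i<..d}")
        case True
        then obtain l where l: "v = w l" "i < l" "l \<le> d" by auto
        then show ?thesis using mem[of l] idx[of l] by auto
      qed auto
      then show ?thesis by (simp add: \<theta>_def subst_subst)
    qed
    then show "P i \<subseteq> P (Suc i)" by (auto simp: P_def \<phi>_def)
    \<comment> \<open>The class of \<open>e - 1\<close> shows that the inclusion is strict.\<close>
    obtain e j where e: "e \<in> edges G" "j \<le> i" "ends G e = {w j, w (Suc i)}"
      using conn[OF i] by blast
    define Z where "Z = ?I +>\<^bsub>?A\<^esub> (mvar e - 1)"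
    have "mvar e + mconst (- 1) \<in> carrier ?A"
      by (intro poly_ring_closed mvar_in_poly_ring mconst_in_poly_ring e)
    then have c: "mvar e - 1 \<in> carrier ?A" by (simp del: poly_ring_simps(1))
    have Z: "Z \<in> carrier ?T"
      using c unfolding Z_def toric_ring_def FactRing_def A_RCOSETS_def' by auto
    have ne: "w j \<noteq> w (Suc i)" "w j \<notin> w ` {i<..d}" "w (Suc i) \<in> w ` {i<..d}"
      "w j \<notin> w ` {Suc i<..d}" "w (Suc i) \<notin> w ` {Suc i<..d}"
      using inj_on_eq_iff[OF inj, of j "Suc i"] i e(2) by (simp_all add: mem)
    have "the_elem (?\<tau> ` Z) = ?\<tau> (mvar e - 1)"
      unfolding Z_def toric_ideal_def by (rule ring_hom_ring.the_elem_simp[OF \<tau> c])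
    also have "\<dots> = mvar (w j) * mvar (w (Suc i)) - 1"
      using ne(1) e(3) by (simp add: toric_map_def subst_diff)
    finally have val: "\<phi> k Z = \<theta> k (mvar (w j)) * \<theta> k (mvar (w (Suc i))) - 1" for k
      by (simp add: \<phi>_def \<theta>_def subst_diff subst_mult)
    have "\<phi> (Suc i) Z = 0" using ne by (simp add: val \<theta>_def)
    then have "Z \<in> P (Suc i)" using Z by (simp add: P_def)
    have "\<phi> i Z = mvar (Suc i) - 1"
      using ne idx[of "Suc i"] i by (simp add: val \<theta>_def)
    moreover have "Poly_Mapping.single (Suc i) (1::nat) \<noteq> 0"
      by (metis lookup_single_eq lookup_zero one_neq_zero)
    ultimately have "Poly_Mapping.lookup (\<phi> i Z) 0 = - 1"
      by (simp add: mvar_def lookup_minus lookup_one lookup_single when_def)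
    then have "Z \<notin> P i" by (auto simp: P_def)
    with \<open>Z \<in> P (Suc i)\<close> show "P i \<noteq> P (Suc i)" by blast
  qed
  show ?thesis
    unfolding krull_dim_def using prime strict by (intro Sup_upper) blast
qed

section \<open>The ladder graphs\<close>

lemma corner_in_ladder: "(nrows n, ncols n) \<in> dom (ladder n t)"
proof (cases "(n, t)" rule: ladder.cases)
  case (3 m t)
  then show ?thesis by (auto simp: Let_def add_row_def add_col_def)
qed (auto simp: nrows_def ncols_def)

lemma dom_ladder_Suc: "dom (ladder n (butlast t)) \<subseteq> dom (ladder (Suc n) t)"
proof (cases n)
  case (Suc m)
  then show ?thesis by (auto simp: Let_def add_row_def add_col_def)
qed auto

text \<open>The list \<open>t\<close> is shortened from the right in each recursive step, so the smaller ladder belongs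
  to another list. Its identity can be left open, because the staircase positions below are the same
  in all ladders.\<close>
lemma ladder_contains_smaller: "k \<le> n \<Longrightarrow> \<exists>s. dom (ladder k s) \<subseteq> dom (ladder n t)"
proof (induction n arbitrary: t)
  case (Suc n)
  show ?case
  proof (cases "k = Suc n")
    case False
    then obtain s where "dom (ladder k s) \<subseteq> dom (ladder n (butlast t))" using Suc by force
    then show ?thesis using dom_ladder_Suc[of n t] by blast
  qed auto
qed auto

text \<open>The path \<open>Col 1, Row 1, Col 2, Row 2, \<dots>\<close>.\<close>
definition staircase :: "nat \<Rightarrow> vertex" where
  "staircase i = (if even i then Col (i div 2 + 1) else Row (i div 2 + 1))"

text \<open>The first two edges, at the positions \<open>(1, 1)\<close> and \<open>(1, 2)\<close>, belong to the smallest
  ladder; every later one sits at the bottom right corner of the ladder with index \<open>i - 2\<close>.\<close>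
lemma staircase_edge:
  assumes "i < n + 3"
  shows "\<exists>r c. (r, c) \<in> dom (ladder n t) \<and> {Row r, Col c} = {staircase i, staircase (Suc i)}"
proof (cases "i < 2")
  case True
  obtain s where s: "dom (ladder 0 s) \<subseteq> dom (ladder n t)" using ladder_contains_smaller[of 0 n t] by auto
  have "(1, Suc i) \<in> dom (ladder 0 s)" using True by (auto simp: less_2_cases_iff)
  moreover have "{Row 1, Col (Suc i)} = {staircase i, staircase (Suc i)}"
    using True by (auto simp: staircase_def less_2_cases_iff)
  ultimately show ?thesis using s by blast
next
  case False
  define k where "k = i - 2"
  have k: "i = k + 2" "k \<le> n" using False assms by (auto simp: k_def)
  have "(nrows k, ncols k) \<in> dom (ladder n t)"
    using ladder_contains_smaller[OF k(2), of t] corner_in_ladder by blast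
  moreover have "{Row (nrows k), Col (ncols k)} = {staircase i, staircase (Suc i)}"
    unfolding k(1) by (cases "even k") (auto simp: staircase_def nrows_def ncols_def)
  ultimately show ?thesis by blast
qed

lemma ends_ladder:
  assumes "ladder n t (r, c) = Some j"
  shows "ends (graph_of_ladder n t) j = {Row r, Col c}"
proof -
  have "(r', c') = (r, c)" if "ladder n t (r', c') = Some j" for r' c'
    using ladder_inj[of n t] assms that by (intro inj_onD[of "ladder n t"]) auto
  then have "{{Row r', Col c'} | r' c'. ladder n t (r', c') = Some j} = {{Row r, Col c}}"
    using assms by blast
  then show ?thesis by (simp add: graph_of_ladder_def)
qed

theorem theorem1p1:
  fixes n :: nat and t :: "bit list"
  assumes "length t = n + 1"
  shows "krull_dim (toric_ring (graph_of_ladder n t) :: (nat, 'k::field) mpoly set ring) = enat (n + 3)"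
proof (rule antisym)
  let ?G = "graph_of_ladder n t"
  let ?R = "Row ` {1..nrows n}" and ?C = "Col ` {1..ncols n}"
  have V: "verts ?G = ?R \<union> ?C" by (simp add: graph_of_ladder_def)
  have ends: "\<exists>r\<in>?R. \<exists>c\<in>?C. ends ?G e = {r, c}" if "e \<in> edges ?G" for e
  proof -
    obtain r c where rc: "ladder n t (r, c) = Some e"
      using \<open>e \<in> edges ?G\<close> by (auto simp: graph_of_ladder_def ran_def)
    then have "(r, c) \<in> {1..nrows n} \<times> {1..ncols n}" using dom_ladder[of n t] by blast
    then show ?thesis using ends_ladder[OF rc] by blast
  qed
  have card: "card (verts ?G) = n + 4"
    unfolding V by (subst card_Un_disjoint) (auto simp: card_image inj_on_def nrows_def ncols_def)
  show "krull_dim (toric_ring ?G :: (nat, 'k) mpoly set ring) \<le> enat (n + 3)"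
  proof -
    have "krull_dim (toric_ring ?G :: (nat, 'k) mpoly set ring) \<le> enat (card (verts ?G) - 1)"
      by (rule krull_dim_toric_ring_le[OF _ _ _ _ V ends]) (auto simp: nrows_def)
    then show ?thesis by (simp add: card add.commute)
  qed
  have "inj_on staircase {..n + 3}"
  proof (rule inj_onI)
    fix i j assume "staircase i = staircase j"
    then have "even i = even j" "i div 2 = j div 2" by (auto simp: staircase_def split: if_splits)
    then show "i = j" by (metis bit_eq_rec)
  qed
  moreover have "\<exists>e\<in>edges ?G. \<exists>j\<le>i. ends ?G e = {staircase j, staircase (Suc i)}" if i: "i < n + 3" for i
  proof -
    obtain r c e where "ladder n t (r, c) = Some e" "{Row r, Col c} = {staircase i, staircase (Suc i)}"
      using staircase_edge[OF i, of t] by blast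
    then show ?thesis using ends_ladder[of n t r c e] by (auto simp: graph_of_ladder_def ran_def)
  qed
  ultimately show "enat (n + 3) \<le> krull_dim (toric_ring ?G :: (nat, 'k) mpoly set ring)"
    by (intro krull_dim_toric_ring_ge) (use ends V in fastforce)+
qed

end
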